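(* Suppose that $\Omega$ is one-dimensional. Then the finite adaptability problem $(\mathrm{Adapt}_k(\Omega))$ with $A(\cdot)$ and $B(\cdot)$ deterministic (i.e. $A(\omega)$ and $B(\omega)$ do not depend on $\omega$) can be solved by the resolution of a single linear program of polynomial size (or a single mixed linear program in case of integral variables).
   Context: The uncertainty set $\Omega$ is a polytope of $\mathbb{R}^n$. $A(\omega)$, $B(\omega)$ are input matrices and $\boldsymbol{b}(\omega)$ is an input vector, all depending affinely on $\omega\in\Omega$; $\boldsymbol{c}$ and $\boldsymbol{d}$ are deterministic vectors. For a positive integer $k$, with $[k]=\{1,\dots,k\}$, the finite adaptability problem $(\mathrm{Adapt}_k(\Omega))$ is $$\min_{\Omega_1,\dots,\Omega_k,\ \boldsymbol{x},\boldsymbol{y}_1,\ldots,\boldsymbol{y}_k}\ \boldsymbol{c}^\top\boldsymbol{x}+\max_{i\in[k]}\boldsymbol{d}^\top\boldsymbol{y}_i\quad\text{s.t.}\quad A(\omega)\boldsymbol{x}+B(\omega)\boldsymbol{y}_i\leq\boldsymbol{b}(\omega)\quad\forall i\in[k]\ \forall\omega\in\Omega_i,$$ where the $\Omega_i$ are constrained to form a cover of $\Omega$. The variables $\boldsymbol{x}$ and $\boldsymbol{y}_i$ are continuous, or can moreover be constrained to be integer, depending on the context. From a computational perspective, only $\boldsymbol{x},\boldsymbol{y}_1,\ldots,\boldsymbol{y}_k$ are expected to be output, and not the $\Omega_i$'s. *)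

theory Defs
  imports
    "Jordan_Normal_Form.DL_Rank"
    "HOL-Library.Extended_Real"
    "HOL-Library.Log_Nat"
    "HOL-Computational_Algebra.Polynomial"
begin

text \<open>
  Dimensions vary inside the statement (the polynomial bound must be uniform in all of them), so
  vectors and matrices are the carrier-based ones, and the few notions of convex geometry that are
  needed are defined for them. All indices start at 0; in particular $[k]$ is \<open>{..<k}\<close>.
\<close>

section \<open>Polytopes\<close>

definition conv_hull :: "nat \<Rightarrow> real vec list \<Rightarrow> real vec set" where
  "conv_hull n vs = {vec n (\<lambda>l. \<Sum>i<length vs. a i * (vs ! i $ l)) | a.
     (\<forall>i<length vs. 0 \<le> a i) \<and> (\<Sum>i<length vs. a i) = 1}"

definition extreme_pt :: "real vec set \<Rightarrow> real vec \<Rightarrow> bool" where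
  "extreme_pt S v \<longleftrightarrow> v \<in> S \<and>
     (\<forall>a\<in>S. \<forall>b\<in>S. \<forall>t. 0 < t \<and> t < 1 \<and> v = (1 - t) \<cdot>\<^sub>v a + t \<cdot>\<^sub>v b \<longrightarrow> a = v \<and> b = v)"

text \<open>Dimension of the direction space of the affine hull, for nonempty \<open>S\<close>.\<close>

definition affine_dim :: "nat \<Rightarrow> real vec set \<Rightarrow> nat" where
  "affine_dim n S = vectorspace.dim class_ring
     (module.span_vs class_ring (module_vec TYPE(real) n) {v - w | v w. v \<in> S \<and> w \<in> S})"

section \<open>Finite adaptability\<close>

record adapt =
  unc :: "real vec set"
  Aof :: "real vec \<Rightarrow> real mat"
  Bof :: "real vec \<Rightarrow> real mat"
  bof :: "real vec \<Rightarrow> real vec"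
  cvec :: "real vec"
  dvec :: "real vec"
  num_pol :: nat
  xdom :: "real vec set"
  ydom :: "real vec set"

definition adapt_feasible ::
    "adapt \<Rightarrow> (nat \<Rightarrow> real vec set) \<Rightarrow> real vec \<Rightarrow> (nat \<Rightarrow> real vec) \<Rightarrow> bool" where
  "adapt_feasible P W x y \<longleftrightarrow>
     (\<Union>i<num_pol P. W i) = unc P \<and> x \<in> xdom P \<and> (\<forall>i<num_pol P. y i \<in> ydom P) \<and>
     (\<forall>i<num_pol P. \<forall>w\<in>W i. Aof P w *\<^sub>v x + Bof P w *\<^sub>v y i \<le> bof P w)"

definition adapt_obj :: "adapt \<Rightarrow> real vec \<Rightarrow> (nat \<Rightarrow> real vec) \<Rightarrow> real" where
  "adapt_obj P x y = cvec P \<bullet> x + Max ((\<lambda>i. dvec P \<bullet> y i) ` {..<num_pol P})"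

definition adapt_value :: "adapt \<Rightarrow> ereal" where
  "adapt_value P = Inf {ereal (adapt_obj P x y) | x y. \<exists>W. adapt_feasible P W x y}"

definition adapt_optimal :: "adapt \<Rightarrow> real vec \<Rightarrow> (nat \<Rightarrow> real vec) \<Rightarrow> bool" where
  "adapt_optimal P x y \<longleftrightarrow> (\<exists>W. adapt_feasible P W x y) \<and>
     (\<forall>W' x' y'. adapt_feasible P W' x' y' \<longrightarrow> adapt_obj P x y \<le> adapt_obj P x' y')"

section \<open>Input data\<close>

text \<open>
  The format of an instance: all dimensions (\<open>n_vert\<close> is the number of vertices of the
  uncertainty polytope) and which coordinates of \<open>x\<close> and of the \<open>y\<^sub>i\<close> must be integer.
\<close>

record format =
  dim_w :: nat
  n_vert :: nat
  n_row :: nat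
  dim_x :: nat
  dim_y :: nat
  n_pol :: nat
  int_x :: "nat set"
  int_y :: "nat set"

definition format_ok :: "format \<Rightarrow> bool" where
  "format_ok F \<longleftrightarrow> n_pol F \<ge> 1 \<and> int_x F \<subseteq> {..<dim_x F} \<and> int_y F \<subseteq> {..<dim_y F}"

definition format_size :: "format \<Rightarrow> nat" where
  "format_size F = dim_w F + n_vert F + n_row F + dim_x F + dim_y F + n_pol F"

text \<open>
  The numerical data, for deterministic \<open>A\<close> and \<open>B\<close>: the right-hand side is
  \<open>b(w) = b_const + b_lin w\<close>, and the uncertainty polytope is given by the list of its vertices.
\<close>

record data =
  A_mat :: "real mat"
  B_mat :: "real mat"
  b_const :: "real vec"
  b_lin :: "real mat"
  c_vec :: "real vec"
  d_vec :: "real vec"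
  verts :: "real vec list"

definition data_ok :: "format \<Rightarrow> data \<Rightarrow> bool" where
  "data_ok F D \<longleftrightarrow>
     A_mat D \<in> carrier_mat (n_row F) (dim_x F) \<and>
     B_mat D \<in> carrier_mat (n_row F) (dim_y F) \<and>
     b_const D \<in> carrier_vec (n_row F) \<and>
     b_lin D \<in> carrier_mat (n_row F) (dim_w F) \<and>
     c_vec D \<in> carrier_vec (dim_x F) \<and>
     d_vec D \<in> carrier_vec (dim_y F) \<and>
     length (verts D) = n_vert F \<and> set (verts D) \<subseteq> carrier_vec (dim_w F) \<and>
     distinct (verts D) \<and> (\<forall>v\<in>set (verts D). extreme_pt (conv_hull (dim_w F) (verts D)) v)"

definition problem :: "format \<Rightarrow> data \<Rightarrow> adapt" where
  "problem F D = \<lparr>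
     unc = conv_hull (dim_w F) (verts D),
     Aof = (\<lambda>w. A_mat D),
     Bof = (\<lambda>w. B_mat D),
     bof = (\<lambda>w. b_const D + b_lin D *\<^sub>v w),
     cvec = c_vec D,
     dvec = d_vec D,
     num_pol = n_pol F,
     xdom = {x \<in> carrier_vec (dim_x F). \<forall>j\<in>int_x F. x $ j \<in> \<int>},
     ydom = {y \<in> carrier_vec (dim_y F). \<forall>j\<in>int_y F. y $ j \<in> \<int>}\<rparr>"

text \<open>Names for the individual numbers occurring in the data.\<close>

datatype datum =
    A_at nat nat | B_at nat nat | b_const_at nat | b_lin_at nat nat
  | c_at nat | d_at nat | vert_at nat nat

primrec datum_val :: "data \<Rightarrow> datum \<Rightarrow> real" where
  "datum_val D (A_at r j) = A_mat D $$ (r, j)"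
| "datum_val D (B_at r j) = B_mat D $$ (r, j)"
| "datum_val D (b_const_at r) = b_const D $ r"
| "datum_val D (b_lin_at r l) = b_lin D $$ (r, l)"
| "datum_val D (c_at j) = c_vec D $ j"
| "datum_val D (d_at j) = d_vec D $ j"
| "datum_val D (vert_at i l) = verts D ! i $ l"

definition data_items :: "format \<Rightarrow> datum set" where
  "data_items F =
     {A_at r j | r j. r < n_row F \<and> j < dim_x F} \<union>
     {B_at r j | r j. r < n_row F \<and> j < dim_y F} \<union>
     {b_const_at r | r. r < n_row F} \<union>
     {b_lin_at r l | r l. r < n_row F \<and> l < dim_w F} \<union>
     {c_at j | j. j < dim_x F} \<union>
     {d_at j | j. j < dim_y F} \<union>
     {vert_at i l | i l. i < n_vert F \<and> l < dim_w F}"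

definition rational_data :: "format \<Rightarrow> data \<Rightarrow> bool" where
  "rational_data F D \<longleftrightarrow> (\<forall>e\<in>data_items F. datum_val D e \<in> \<rat>)"

text \<open>
  Binary encoding length of a rational number \<open>a / b\<close> in lowest terms (one bit for the sign); it
  is only meant for rational arguments.
\<close>

definition int_bits :: "int \<Rightarrow> nat" where
  "int_bits a = 1 + floorlog 2 (nat \<bar>a\<bar>)"

definition bits :: "real \<Rightarrow> nat" where
  "bits r = (case quotient_of (THE q. real_of_rat q = r) of (a, b) \<Rightarrow> int_bits a + int_bits b)"

text \<open>
  The number of policies counts in unary: already the required output
  \<open>(x, y\<^sub>1, \<dots>, y\<^sub>k)\<close> consists of \<open>k + 1\<close> vectors.
\<close>

definition data_size :: "format \<Rightarrow> data \<Rightarrow> nat" where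
  "data_size F D = n_pol F + (\<Sum>e\<in>data_items F. bits (datum_val D e))"

section \<open>(Mixed-integer) linear programs\<close>

text \<open>
  Minimize \<open>obj \<bullet> z\<close> subject to \<open>lhs z \<le> rhs\<close>, with \<open>z\<^sub>j\<close> integer for \<open>j\<close> in \<open>int_vars\<close>.
  The entries are real numbers for a program, and expressions in the input data for
  a program scheme.
\<close>

record 'a program =
  obj :: "'a vec"
  lhs :: "'a mat"
  rhs :: "'a vec"
  int_vars :: "nat set"

definition program_ok :: "'a program \<Rightarrow> bool" where
  "program_ok L \<longleftrightarrow> lhs L \<in> carrier_mat (dim_vec (rhs L)) (dim_vec (obj L)) \<and>
     int_vars L \<subseteq> {..<dim_vec (obj L)}"

definition lp_feasible :: "real program \<Rightarrow> real vec \<Rightarrow> bool" where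
  "lp_feasible L z \<longleftrightarrow> z \<in> carrier_vec (dim_vec (obj L)) \<and> lhs L *\<^sub>v z \<le> rhs L \<and>
     (\<forall>j\<in>int_vars L. z $ j \<in> \<int>)"

definition lp_value :: "real program \<Rightarrow> ereal" where
  "lp_value L = Inf {ereal (obj L \<bullet> z) | z. lp_feasible L z}"

definition lp_optimal :: "real program \<Rightarrow> real vec \<Rightarrow> bool" where
  "lp_optimal L z \<longleftrightarrow> lp_feasible L z \<and> (\<forall>z'. lp_feasible L z' \<longrightarrow> obj L \<bullet> z \<le> obj L \<bullet> z')"

definition program_size :: "('a \<Rightarrow> nat) \<Rightarrow> 'a program \<Rightarrow> nat" where
  "program_size f L =
     (\<Sum>j<dim_vec (obj L). f (obj L $ j)) +
     (\<Sum>i<dim_row (lhs L). \<Sum>j<dim_col (lhs L). f (lhs L $$ (i, j))) +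
     (\<Sum>i<dim_vec (rhs L). f (rhs L $ i))"

section \<open>Program schemes\<close>

text \<open>
  That a problem is solved by one linear program is meaningful only if the program is written
  down from the data, and not chosen knowing an optimal solution. Hence the entries of the
  program are division-free arithmetic expressions in the input numbers, fixed once the format
  of the instance is known.
\<close>

datatype 'e expr = Numb int | Entry 'e | Plus "'e expr" "'e expr" | Times "'e expr" "'e expr"

primrec expr_val :: "('e \<Rightarrow> real) \<Rightarrow> 'e expr \<Rightarrow> real" where
  "expr_val f (Numb a) = of_int a"
| "expr_val f (Entry e) = f e"
| "expr_val f (Plus s t) = expr_val f s + expr_val f t"
| "expr_val f (Times s t) = expr_val f s * expr_val f t"

primrec expr_size :: "'e expr \<Rightarrow> nat" where
  "expr_size (Numb a) = int_bits a"
| "expr_size (Entry e) = 1"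
| "expr_size (Plus s t) = 1 + expr_size s + expr_size t"
| "expr_size (Times s t) = 1 + expr_size s + expr_size t"

text \<open>
  The original variables \<open>x, y\<^sub>1, \<dots>, y\<^sub>k\<close> are the first variables of the program, in this order;
  the remaining ones are auxiliary.
\<close>

definition scheme_ok :: "format \<Rightarrow> datum expr program \<Rightarrow> bool" where
  "scheme_ok F T \<longleftrightarrow> program_ok T \<and> dim_x F + n_pol F * dim_y F \<le> dim_vec (obj T) \<and>
     (\<forall>t \<in> vec_set (obj T) \<union> elements_mat (lhs T) \<union> vec_set (rhs T). set_expr t \<subseteq> data_items F)"

definition instantiate :: "data \<Rightarrow> datum expr program \<Rightarrow> real program" where
  "instantiate D T = \<lparr>
     obj = map_vec (expr_val (datum_val D)) (obj T),
     lhs = map_mat (expr_val (datum_val D)) (lhs T),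
     rhs = map_vec (expr_val (datum_val D)) (rhs T),
     int_vars = int_vars T\<rparr>"

definition x_part :: "format \<Rightarrow> real vec \<Rightarrow> real vec" where
  "x_part F z = vec (dim_x F) (\<lambda>j. z $ j)"

definition y_part :: "format \<Rightarrow> real vec \<Rightarrow> nat \<Rightarrow> real vec" where
  "y_part F z i = vec (dim_y F) (\<lambda>j. z $ (dim_x F + i * dim_y F + j))"

text \<open>
  Equality of the values in the extended reals includes infeasibility (value \<open>\<infinity>\<close>) and
  unboundedness (value \<open>-\<infinity>\<close>).
\<close>

definition solves :: "real program \<Rightarrow> format \<Rightarrow> data \<Rightarrow> bool" where
  "solves L F D \<longleftrightarrow>
     lp_value L = adapt_value (problem F D) \<and>
     (\<forall>z. lp_optimal L z \<longrightarrow> adapt_optimal (problem F D) (x_part F z) (y_part F z)) \<and>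
     ((\<exists>x y. adapt_optimal (problem F D) x y) \<longrightarrow> (\<exists>z. lp_optimal L z))"

end

theory Submission
  imports Defs
begin

text \<open>
  Parametrize the segment \<open>\<Omega>\<close> by \<open>[0,1]\<close>. As \<open>A\<close> and \<open>B\<close> are deterministic, each policy is feasible on a
  closed subinterval. If \<open>k\<close> closed sets cover \<open>[0,1]\<close>, then there are breakpoints
  \<open>0 = t\<^sub>0, \<dots>, t\<^sub>k = 1\<close> such that, after reordering and possibly repeating policies, policy \<open>i\<close> is
  feasible at \<open>t\<^sub>i\<close> and \<open>t\<^sub>i\<^sub>+\<^sub>1\<close>; reordering and repetition do not increase the objective. Conversely,
  feasibility at these two points gives feasibility between them. With the breakpoints as additional
  variables this is linear, since the right-hand side is affine in the breakpoint.
\<close>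

section \<open>Polytopes of dimension one\<close>

text \<open>Independent subsets of \<open>S\<close> have at most \<open>n\<close> elements, so a
  maximal one exists, and maximality puts all of \<open>S\<close> into its span. The basis is drawn
  from \<open>S\<close> itself so that, for a set of differences, the direction found is a
  difference of two points.\<close>

lemma (in vec_space) exists_li_spanning:
  assumes S: "S \<subseteq> carrier_vec n"
  obtains U where "U \<subseteq> S" "finite U" "lin_indpt U" "span U = span S"
    "vectorspace.dim class_ring (span_vs S) = card U"
proof -
  have "\<exists>U. finite U \<and> maximal U (\<lambda>T. T \<subseteq> S \<and> lin_indpt T)"
  proof (rule maximal_exists[where N = n and B = "{}"])
    show "finite T \<and> card T \<le> n" if "T \<subseteq> S \<and> lin_indpt T" for T
      using that S li_le_dim[of T] fin_dim dim_is_n by auto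
    show "{} \<subseteq> S \<and> lin_indpt {}"
      using finite_lin_indpt2[of "{}"] by auto
  qed
  then obtain U where U: "finite U" "maximal U (\<lambda>T. T \<subseteq> S \<and> lin_indpt T)" by blast
  have US: "U \<subseteq> S" and li: "lin_indpt U" using U(2) by (auto simp: maximal_def)
  have UC: "U \<subseteq> carrier_vec n" using US S by blast
  have "s \<in> span U" if s: "s \<in> S" for s
  proof (rule ccontr)
    assume ns: "s \<notin> span U"
    then have "s \<notin> U" using in_own_span[OF UC] by blast
    moreover have "lin_indpt (U \<union> {s})"
      using lin_dep_iff_in_span[OF UC li _ \<open>s \<notin> U\<close>] ns s S by auto
    ultimately show False using U(2) US s unfolding maximal_def by blast
  qed
  then have "span S \<subseteq> span U" using span_is_subset[of S "span U"] span_is_submodule[OF UC] by blast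
  then have sp: "span U = span S" using span_is_monotone[OF US] by blast
  have "vectorspace.dim class_ring (span_vs U) = card U"
    by (rule dim_span[OF UC U(1)]) (use li in \<open>auto simp: maximal_def\<close>)
  then show ?thesis using that US U(1) li sp by metis
qed

text \<open>A basis of the direction space chosen among the differences has one element
  \<open>u\<close>, and every difference lies in its span.\<close>

lemma affine_dim_1D:
  assumes S: "S \<subseteq> carrier_vec n" and d: "affine_dim n S = 1"
  obtains u where "u \<in> carrier_vec n" "u \<noteq> 0\<^sub>v n" "u \<in> {v - w | v w. v \<in> S \<and> w \<in> S}"
    "\<And>v w. v \<in> S \<Longrightarrow> w \<in> S \<Longrightarrow> \<exists>c. v - w = c \<cdot>\<^sub>v u"
proof -
  interpret V: vec_space "TYPE(real)" n .
  let ?D = "{v - w | v w. v \<in> S \<and> w \<in> S}"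
  have D: "?D \<subseteq> carrier_vec n" using S minus_carrier_vec by blast
  obtain U where U: "U \<subseteq> ?D" "finite U" "V.lin_indpt U" "V.span U = V.span ?D"
    "vectorspace.dim class_ring (V.span_vs ?D) = card U"
    using V.exists_li_spanning[OF D] .
  then have "card U = 1" using d by (simp add: affine_dim_def)
  then obtain u where u: "U = {u}" by (auto simp: card_1_singleton_iff)
  have uc: "u \<in> carrier_vec n" using u U(1) D by auto
  show ?thesis
  proof
    show "u \<in> carrier_vec n" by fact
    \<comment> \<open>The reals are not the zero ring; over a nontrivial ring an independent set
      does not contain the zero vector.\<close>
    have "(UNIV :: real set) \<noteq> {0}" by (metis UNIV_I singletonD zero_neq_one)
    then show "u \<noteq> 0\<^sub>v n" using V.zero_nin_lin_indpt[of U] U(3) u uc by (auto simp: class_ring_simps)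
    show "u \<in> ?D" using u U(1) by auto
    fix v w assume "v \<in> S" "w \<in> S"
    then have "v - w \<in> V.span {u}" using U(4) u V.in_own_span[OF D] by blast
    then obtain a where "V.lincomb a {u} = v - w"
      using V.finite_in_span[of "{u}" "v - w"] uc by auto
    moreover have "V.lincomb a {u} = a u \<cdot>\<^sub>v u"
      using uc by (simp add: V.lincomb_def)
    ultimately show "\<exists>c. v - w = c \<cdot>\<^sub>v u" by metis
  qed
qed

lemma convex_comb_of_less:
  fixes a b c :: real
  assumes "a < b" "b < c"
  shows "\<exists>t. 0 < t \<and> t < 1 \<and> b = (1 - t) * a + t * c"
proof -
  define t where "t = (b - a) / (c - a)"
  have "t * (c - a) = b - a" using assms by (simp add: t_def)
  then have "b = (1 - t) * a + t * c" by (simp add: algebra_simps)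
  moreover have "0 < t" "t < 1" using assms by (auto simp: t_def)
  ultimately show ?thesis by blast
qed

text \<open>The point with the middle parameter is a proper convex combination of the outer two,
  which extremality permits only if they coincide with it.\<close>

lemma extreme_not_between:
  assumes ext: "extreme_pt S b" and S: "a \<in> S" "c \<in> S"
    and v: "w \<in> carrier_vec n" "u \<in> carrier_vec n"
    and eq: "a = w + p \<cdot>\<^sub>v u" "b = w + q \<cdot>\<^sub>v u" "c = w + r \<cdot>\<^sub>v u"
    and lt: "p < q" "q < r"
  shows "a = b"
proof -
  obtain t where t: "0 < t" "t < 1" "q = (1 - t) * p + t * r"
    using convex_comb_of_less[OF lt] by auto
  have "b = (1 - t) \<cdot>\<^sub>v a + t \<cdot>\<^sub>v c"
    unfolding eq t(3) using v by (intro eq_vecI) (auto simp: algebra_simps)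
  then show ?thesis using ext S t unfolding extreme_pt_def by blast
qed

text \<open>Three parameters either contain a coincidence or have a strict middle one: the cases are
  three coincidences and six strict orders.\<close>

lemma collinear_extreme_pts:
  assumes ext: "extreme_pt S x" "extreme_pt S y" "extreme_pt S z"
    and v: "w \<in> carrier_vec n" "u \<in> carrier_vec n"
    and eq: "x = w + p \<cdot>\<^sub>v u" "y = w + q \<cdot>\<^sub>v u" "z = w + r \<cdot>\<^sub>v u"
  shows "x = y \<or> y = z \<or> x = z"
proof -
  have S: "x \<in> S" "y \<in> S" "z \<in> S" using ext by (auto simp: extreme_pt_def)
  note E = extreme_not_between[OF _ _ _ v]
  consider "p = q" | "q = r" | "p = r" | "p < q" "q < r" | "q < p" "p < r" | "p < r" "r < q"
    | "r < q" "q < p" | "r < p" "p < q" | "q < r" "r < p" by linarith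
  then show ?thesis
  proof cases
    case 4 then show ?thesis using E[OF ext(2) S(1,3) eq] by blast
  next
    case 5 then show ?thesis using E[OF ext(1) S(2,3) eq(2,1,3)] by blast
  next
    case 6 then show ?thesis using E[OF ext(3) S(1,2) eq(1,3,2)] by blast
  next
    case 7 then show ?thesis using E[OF ext(2) S(3,1) eq(3,2,1)] by blast
  next
    case 8 then show ?thesis using E[OF ext(1) S(3,2) eq(3,1,2)] by blast
  next
    case 9 then show ?thesis using E[OF ext(3) S(2,1) eq(2,3,1)] by blast
  qed (use eq in auto)
qed

lemma conv_hull_carrier: "conv_hull n vs \<subseteq> carrier_vec n"
  by (auto simp: conv_hull_def)

text \<open>No vertices give an empty hull and a single vertex forces \<open>u\<close> to be zero;
  three vertices would be three distinct extreme points on one line.\<close>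

lemma length_eq_2_of_affine_dim_1:
  assumes vs: "distinct vs" "\<forall>v\<in>set vs. extreme_pt (conv_hull n vs) v"
    and dim: "affine_dim n (conv_hull n vs) = 1"
  shows "length vs = 2"
proof -
  let ?S = "conv_hull n vs"
  obtain u where u: "u \<in> carrier_vec n" "u \<noteq> 0\<^sub>v n" "u \<in> {v - w | v w. v \<in> ?S \<and> w \<in> ?S}"
    and col: "\<And>v w. v \<in> ?S \<Longrightarrow> w \<in> ?S \<Longrightarrow> \<exists>c. v - w = c \<cdot>\<^sub>v u"
    using affine_dim_1D[OF conv_hull_carrier dim] by blast
  obtain v w where vw: "v \<in> ?S" "w \<in> ?S" "u = v - w" using u(3) by auto
  have wc: "w \<in> carrier_vec n" using vw conv_hull_carrier by auto
  have "length vs \<noteq> 0"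
    using vw(1) by (auto simp: conv_hull_def)
  moreover have "length vs \<noteq> 1"
  proof
    assume l: "length vs = 1"
    have "v = w" using vw(1,2) l by (auto simp: conv_hull_def)
    then show False using u(2) vw(3) wc by auto
  qed
  moreover have "\<not> 3 \<le> length vs"
  proof
    assume l: "3 \<le> length vs"
    define c where "c i = (SOME c. vs ! i = w + c \<cdot>\<^sub>v u)" for i
    have c: "vs ! i = w + c i \<cdot>\<^sub>v u" if "i < 3" for i
    proof -
      have "vs ! i \<in> ?S" using vs(2) l that by (auto simp: extreme_pt_def)
      then obtain d where d: "vs ! i - w = d \<cdot>\<^sub>v u" and vc: "vs ! i \<in> carrier_vec n"
        using col[OF _ vw(2)] conv_hull_carrier by blast
      have "vs ! i $ l = (w + d \<cdot>\<^sub>v u) $ l" if "l < n" for l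
        using arg_cong[OF d, of "\<lambda>x. x $ l"] that wc vc u(1) by auto
      then have "vs ! i = w + d \<cdot>\<^sub>v u"
        using wc vc u(1) by (intro eq_vecI) auto
      then show ?thesis unfolding c_def by (rule someI)
    qed
    have ext: "extreme_pt ?S (vs ! i)" if "i < 3" for i using vs(2) l that by auto
    have "vs ! 0 = vs ! 1 \<or> vs ! 1 = vs ! 2 \<or> vs ! 0 = vs ! 2"
      by (rule collinear_extreme_pts[OF ext ext ext wc u(1) c c c]) auto
    moreover have "vs \<noteq> []" using l by auto
    ultimately show False using l nth_eq_iff_index_eq[OF vs(1), of 0 1] nth_eq_iff_index_eq[OF vs(1), of 1 2]
        nth_eq_iff_index_eq[OF vs(1), of 0 2] by auto
  qed
  ultimately show ?thesis by linarith
qed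

section \<open>Covers of an interval\<close>

text \<open>Induction on the number of sets. Follow a set containing \<open>a\<close> up to its last
  point \<open>m\<close> in \<open>{a..b}\<close>. The other sets cover \<open>{m<..b}\<close> and,
  their union being closed, also \<open>m\<close>; the chain continues from \<open>m\<close> without
  the set just used.\<close>

lemma closed_cover_chain:
  fixes J :: "'i \<Rightarrow> real set"
  assumes "finite I" "\<And>i. i \<in> I \<Longrightarrow> closed (J i)" "a \<le> b" "{a..b} \<subseteq> (\<Union>i\<in>I. J i)"
  shows "\<exists>\<sigma> t. t 0 = a \<and> t (card I) = b \<and>
    (\<forall>j<card I. \<sigma> j \<in> I \<and> t j \<in> J (\<sigma> j) \<and> t (Suc j) \<in> J (\<sigma> j))"
  using assms
proof (induction "card I" arbitrary: I a)
  case 0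
  then show ?case by auto
next
  case (Suc n)
  have "a \<in> {a..b}" using Suc.prems(3) by simp
  then obtain i where i: "i \<in> I" "a \<in> J i" using Suc.prems(4) by blast
  have "compact (J i \<inter> {a..b})"
    using Suc.prems(2)[OF i(1)] by (subst Int_commute) (intro compact_Int_closed compact_Icc)
  moreover have "J i \<inter> {a..b} \<noteq> {}" using i(2) Suc.prems(3) by auto
  ultimately obtain m where m: "m \<in> J i" "a \<le> m" "m \<le> b"
    and max: "\<And>x. x \<in> J i \<Longrightarrow> a \<le> x \<Longrightarrow> x \<le> b \<Longrightarrow> x \<le> m"
    using compact_attains_sup[of "J i \<inter> {a..b}"] by (metis IntD1 IntD2 IntI atLeastAtMost_iff)
  show ?case
  proof (cases "m = b")
    case True
    \<comment> \<open>Exactly \<open>card I\<close> links are required, so after reaching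
      \<open>b\<close> in the first link the chain stays there and repeats the set
      \<open>i\<close>.\<close>
    show ?thesis
      by (rule exI[of _ "\<lambda>_. i"], rule exI[of _ "\<lambda>j. if j = 0 then a else b"])
        (use i(1,2) m(1) True Suc.hyps(2)[symmetric] in simp)
  next
    case False
    let ?I = "I - {i}"
    let ?U = "\<Union>l\<in>?I. J l"
    have card: "n = card ?I" using Suc.hyps(2) Suc.prems(1) i(1) by simp
    have cl: "closed ?U" using Suc.prems(1,2) by (intro closed_UN) auto
    have sub: "{m<..b} \<subseteq> ?U"
    proof
      fix x assume x: "x \<in> {m<..b}"
      then have "x \<notin> J i" using max[of x] m(2) by auto
      moreover have "x \<in> {a..b}" using x m(2) by auto
      ultimately show "x \<in> ?U" using Suc.prems(4) by blast
    qed
    have "m \<in> ?U"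
    proof (rule ccontr)
      assume "m \<notin> ?U"
      then have "m \<in> - ?U" by (simp only: Compl_iff not_False_eq_True)
      moreover have "open (- ?U)" using cl by (simp only: closed_def)
      ultimately obtain e where e: "e > 0" "\<And>x. dist x m < e \<Longrightarrow> x \<in> - ?U"
        by (metis open_dist)
      \<comment> \<open>A point of \<open>{m<..b}\<close> at distance less than \<open>e\<close>
        from \<open>m\<close>: the cap keeps it in the interval, and \<open>m < b\<close> makes it
        differ from \<open>m\<close>.\<close>
      define x where "x = min b (m + e / 2)"
      have "dist x m < e" using e(1) m(3) by (auto simp: x_def dist_real_def)
      moreover have "x \<in> {m<..b}" using e(1) m(3) False by (auto simp: x_def)
      ultimately show False using subsetD[OF sub] e(2)[of x] by (metis ComplD)
    qed
    moreover have "{m..b} = insert m {m<..b}" using m(3) by auto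
    ultimately have cov: "{m..b} \<subseteq> ?U" using sub by simp
    have "finite ?I" "\<And>l. l \<in> ?I \<Longrightarrow> closed (J l)" using Suc.prems(1,2) by auto
    from Suc.hyps(1)[OF card this m(3) cov] obtain \<sigma> t where \<sigma>t: "t 0 = m" "t n = b"
      "\<forall>j<n. \<sigma> j \<in> ?I \<and> t j \<in> J (\<sigma> j) \<and> t (Suc j) \<in> J (\<sigma> j)"
      unfolding card[symmetric] by blast
    define \<sigma>' where "\<sigma>' j = (case j of 0 \<Rightarrow> i | Suc j \<Rightarrow> \<sigma> j)" for j
    define t' where "t' j = (case j of 0 \<Rightarrow> a | Suc j \<Rightarrow> t j)" for j
    have "\<forall>j<Suc n. \<sigma>' j \<in> I \<and> t' j \<in> J (\<sigma>' j) \<and> t' (Suc j) \<in> J (\<sigma>' j)"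
      using \<sigma>t i m by (auto simp: \<sigma>'_def t'_def split: nat.split)
    then show ?thesis
      unfolding Suc.hyps(2)[symmetric]
      by (intro exI[of _ \<sigma>'] exI[of _ t']) (auto simp: t'_def \<sigma>t)
  qed
qed

text \<open>A discrete intermediate value argument for a possibly non-monotone \<open>t\<close>:
  either an earlier link already passes \<open>s\<close>, or \<open>t k \<le> s\<close> and the last
  link does.\<close>

lemma chain_crosses:
  fixes t :: "nat \<Rightarrow> real"
  assumes "t 0 \<le> s" "s \<le> t k" "0 < k"
  shows "\<exists>i<k. t i \<le> s \<and> s \<le> t (Suc i)"
  using assms(2,3)
proof (induction k)
  case (Suc k)
  then show ?case
  proof (cases "0 < k \<and> s \<le> t k")
    case True
    then show ?thesis using Suc.IH less_Suc_eq by blast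
  next
    case False
    then have "t k \<le> s" using assms(1) by (cases "k = 0") auto
    then show ?thesis using Suc.prems(1) by blast
  qed
qed simp

text \<open>An affine function on an interval is smallest at the left end if its slope is
  nonnegative and at the right end otherwise. This carries feasibility from two consecutive
  breakpoints to the points between them.\<close>

lemma affine_ge_between:
  fixes \<beta> :: real
  assumes "v \<le> \<alpha> + \<beta> * p" "v \<le> \<alpha> + \<beta> * q" "p \<le> s" "s \<le> q"
  shows "v \<le> \<alpha> + \<beta> * s"
proof (cases "0 \<le> \<beta>")
  case True
  then show ?thesis using assms(1) mult_left_mono[OF assms(3) True] by linarith
next
  case False
  then show ?thesis using assms(2) mult_left_mono_neg[OF assms(4), of \<beta>] by linarith
qed

section \<open>Encoding length of expressions\<close>

text \<open>The fraction may be unreduced, so sums and products require no cancellation and the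
  exponents essentially add up. Lowest terms enter only in the conversions from and to
  \<open>bits\<close>.\<close>

definition num_den_below :: "real \<Rightarrow> nat \<Rightarrow> bool" where
  "num_den_below r q \<longleftrightarrow>
     (\<exists>a b. r = of_int a / of_int b \<and> 0 < b \<and> \<bar>a\<bar> < 2 ^ q \<and> b < 2 ^ q)"

text \<open>Injectivity of \<open>of_rat\<close> makes the description in \<open>bits\<close>
  unique; dividing by the gcd gives the normal form returned by \<open>quotient_of\<close>.\<close>

lemma bits_Fract:
  assumes "0 < b" "r = of_int a / of_int b"
  shows "bits r = int_bits (a div gcd a b) + int_bits (b div gcd a b)"
proof -
  have "(THE q. real_of_rat q = r) = Rat.Fract a b"
    using assms by (intro the_equality) (auto simp: of_rat_rat simp flip: of_rat_eq_iff[where 'a = real])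
  then show ?thesis
    using assms(1) by (simp add: bits_def quotient_of_Fract normalize_def Let_def)
qed

text \<open>The 1 taken off is the sign bit counted by \<open>int_bits\<close>.\<close>

lemma abs_lt_power_of_int_bits: "\<bar>a\<bar> < 2 ^ (int_bits a - 1)"
proof -
  have "nat \<bar>a\<bar> < 2 ^ floorlog 2 (nat \<bar>a\<bar>)" by (intro floorlog_leD) auto
  then have "int (nat \<bar>a\<bar>) < int (2 ^ floorlog 2 (nat \<bar>a\<bar>))" by (simp only: of_nat_less_iff)
  then show ?thesis by (simp add: int_bits_def)
qed

lemma int_bits_le: "\<bar>a\<bar> < 2 ^ q \<Longrightarrow> int_bits a \<le> Suc q"
  unfolding int_bits_def by (simp add: floorlog_leI nat_less_iff)

text \<open>Cancelling the gcd can only shrink both numbers, and each then takes at most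
  \<open>q\<close> bits and a sign bit.\<close>

lemma bits_le_of_num_den_below:
  assumes "num_den_below r q"
  shows "bits r \<le> 2 * q + 2"
proof -
  obtain a b where ab: "r = of_int a / of_int b" "0 < b" "\<bar>a\<bar> < 2 ^ q" "b < 2 ^ q"
    using assms by (auto simp: num_den_below_def)
  have g: "1 \<le> gcd a b" using ab(2) gcd_pos_int[of a b] by linarith
  have "\<bar>x div gcd a b\<bar> \<le> \<bar>x\<bar>" if "gcd a b dvd x" for x
  proof -
    have "\<bar>x div gcd a b\<bar> * 1 \<le> \<bar>x div gcd a b\<bar> * gcd a b"
      using g by (intro mult_left_mono) auto
    also have "\<dots> = \<bar>x div gcd a b * gcd a b\<bar>" by (simp add: abs_mult)
    also have "\<dots> = \<bar>x\<bar>" using that by simp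
    finally show ?thesis by simp
  qed
  from this[of a] this[of b] have "int_bits (a div gcd a b) \<le> Suc q" "int_bits (b div gcd a b) \<le> Suc q"
    using ab by (auto intro!: int_bits_le)
  then show ?thesis using bits_Fract[OF ab(2,1)] by simp
qed

lemma num_den_below_of_bits:
  assumes "r \<in> \<rat>"
  shows "num_den_below r (bits r)"
proof -
  obtain q where q: "r = of_rat q" using assms by (auto elim: Rats_cases)
  obtain a b where ab: "quotient_of q = (a, b)" by force
  have b: "0 < b" and "q = of_int a / of_int b" and cop: "coprime a b"
    using quotient_of_denom_pos[OF ab] quotient_of_div[OF ab] quotient_of_coprime[OF ab] by auto
  then have r: "r = of_int a / of_int b" using q by (simp add: of_rat_divide)
  have bits: "bits r = int_bits a + int_bits b"
    using bits_Fract[OF b r] cop by simp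
  have "\<bar>x\<bar> < 2 ^ bits r" if "int_bits x \<le> bits r" for x
  proof -
    have "(2::int) ^ (int_bits x - 1) \<le> 2 ^ bits r" using that by (intro power_increasing) auto
    then show ?thesis using abs_lt_power_of_int_bits[of x] by linarith
  qed
  from this[of a] this[of b] show ?thesis
    unfolding num_den_below_def using r b bits by (intro exI[of _ a] exI[of _ b]) auto
qed

lemma num_den_below_mono:
  assumes "num_den_below r p" "p \<le> q"
  shows "num_den_below r q"
proof -
  have "(2::int) ^ p \<le> 2 ^ q" using assms(2) by (intro power_increasing) auto
  moreover obtain a b where "r = of_int a / of_int b" "0 < b" "\<bar>a\<bar> < 2 ^ p" "b < 2 ^ p"
    using assms(1) by (auto simp: num_den_below_def)
  ultimately show ?thesis unfolding num_den_below_def by (intro exI[of _ a] exI[of _ b] conjI) (assumption | linarith)+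
qed

lemma num_den_below_mult:
  assumes "num_den_below r p" "num_den_below s q"
  shows "num_den_below (r * s) (p + q)"
proof -
  obtain a b c d where
    r: "r = of_int a / of_int b" "0 < b" "\<bar>a\<bar> < 2 ^ p" "b < 2 ^ p" and
    s: "s = of_int c / of_int d" "0 < d" "\<bar>c\<bar> < 2 ^ q" "d < 2 ^ q"
    using assms by (auto simp: num_den_below_def)
  have "\<bar>a * c\<bar> < 2 ^ (p + q)"
    unfolding abs_mult power_add using r s by (intro mult_strict_mono') auto
  moreover have "b * d < 2 ^ (p + q)"
    unfolding power_add using r s by (intro mult_strict_mono') auto
  ultimately show ?thesis
    unfolding num_den_below_def using r s by (intro exI[of _ "a * c"] exI[of _ "b * d"]) auto
qed

text \<open>Over the denominator \<open>b * d\<close> the numerator is a sum of two products, each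
  below \<open>2 ^ (p + q)\<close> in absolute value; hence one extra bit.\<close>

lemma num_den_below_add:
  assumes "num_den_below r p" "num_den_below s q"
  shows "num_den_below (r + s) (Suc (p + q))"
proof -
  obtain a b c d where
    r: "r = of_int a / of_int b" "0 < b" "\<bar>a\<bar> < 2 ^ p" "b < 2 ^ p" and
    s: "s = of_int c / of_int d" "0 < d" "\<bar>c\<bar> < 2 ^ q" "d < 2 ^ q"
    using assms by (auto simp: num_den_below_def)
  have "\<bar>a * d\<bar> < 2 ^ (p + q)"
    unfolding abs_mult power_add using r s by (intro mult_strict_mono') auto
  moreover have "\<bar>c * b\<bar> < 2 ^ (p + q)"
    unfolding abs_mult power_add using r s by (subst mult.commute, intro mult_strict_mono') auto
  moreover have "b * d < 2 ^ (p + q)"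
    unfolding power_add using r s by (intro mult_strict_mono') auto
  moreover have "r + s = of_int (a * d + c * b) / of_int (b * d)"
    using r s by (simp add: field_simps)
  ultimately show ?thesis
    unfolding num_den_below_def using r s
    by (intro exI[of _ "a * d + c * b"] exI[of _ "b * d"]) auto
qed

text \<open>The extra bit of an addition is paid for by the unit that its node contributes to
  \<open>expr_size\<close>, and products just add exponents. Hence the length grows linearly with
  the expression tree.\<close>

lemma num_den_below_expr_val:
  assumes "\<And>x. x \<in> set_expr e \<Longrightarrow> f x \<in> \<rat> \<and> bits (f x) \<le> M"
  shows "num_den_below (expr_val f e) (expr_size e * (M + 1))"
  using assms
proof (induction e)
  case (Numb a)
  have "num_den_below (of_int a) (int_bits a)"
    unfolding num_den_below_def
  proof (intro exI conjI)
    have "(2::int) ^ (int_bits a - 1) \<le> 2 ^ int_bits a" by (intro power_increasing) auto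
    then show "\<bar>a\<bar> < 2 ^ int_bits a" using abs_lt_power_of_int_bits[of a] by linarith
    show "(1::int) < 2 ^ int_bits a" by (intro one_less_power) (auto simp: int_bits_def)
  qed auto
  then show ?case by (auto elim: num_den_below_mono)
next
  case (Entry x)
  then have "num_den_below (f x) (bits (f x))" "bits (f x) \<le> M + 1"
    using num_den_below_of_bits[of "f x"] by (auto intro: le_SucI)
  then show ?case by (auto elim: num_den_below_mono)
next
  case (Plus s t)
  have "num_den_below (expr_val f s + expr_val f t)
     (Suc (expr_size s * (M + 1) + expr_size t * (M + 1)))"
    using Plus by (intro num_den_below_add) auto
  then show ?case by (auto elim!: num_den_below_mono simp: algebra_simps)
next
  case (Times s t)
  have "num_den_below (expr_val f s * expr_val f t) (expr_size s * (M + 1) + expr_size t * (M + 1))"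
    using Times by (intro num_den_below_mult) auto
  then show ?case by (auto elim!: num_den_below_mono simp: algebra_simps)
qed

lemma expr_size_pos: "1 \<le> expr_size e"
  by (cases e) (auto simp: int_bits_def)

lemma bits_expr_val_le:
  assumes "\<And>x. x \<in> set_expr e \<Longrightarrow> f x \<in> \<rat> \<and> bits (f x) \<le> M"
  shows "bits (expr_val f e) \<le> expr_size e * (2 * M + 4)"
proof -
  have "bits (expr_val f e) \<le> 2 * (expr_size e * (M + 1)) + 2"
    by (intro bits_le_of_num_den_below num_den_below_expr_val assms)
  \<comment> \<open>The additive 2 is absorbed because \<open>expr_size e\<close> is at least
    1.\<close>
  also have "\<dots> \<le> expr_size e * (2 * M + 4)"
    using expr_size_pos[of e] by (simp add: algebra_simps)
  finally show ?thesis .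
qed

text \<open>Separates the encoding length into a factor depending on the scheme and one depending on
  the lengths of the input numbers.\<close>

lemma program_size_instantiate_le:
  assumes T: "scheme_ok F T" and M: "\<And>x. x \<in> data_items F \<Longrightarrow> datum_val D x \<in> \<rat> \<and> bits (datum_val D x) \<le> M"
  shows "program_size bits (instantiate D T) \<le> program_size expr_size T * (2 * M + 4)"
proof -
  have *: "bits (expr_val (datum_val D) e) \<le> expr_size e * (2 * M + 4)"
    if "e \<in> vec_set (obj T) \<union> elements_mat (lhs T) \<union> vec_set (rhs T)" for e
    using that T M unfolding scheme_ok_def by (intro bits_expr_val_le) blast
  have o: "obj T $ j \<in> vec_set (obj T)" if "j < dim_vec (obj T)" for j
    using that by (auto simp: vec_set_def)
  have r: "rhs T $ j \<in> vec_set (rhs T)" if "j < dim_vec (rhs T)" for j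
    using that by (auto simp: vec_set_def)
  have l: "lhs T $$ (i, j) \<in> elements_mat (lhs T)" if "i < dim_row (lhs T)" "j < dim_col (lhs T)" for i j
    using that by (intro elements_matI[OF carrier_matI]) auto
  show ?thesis
    unfolding program_size_def instantiate_def
    by (simp add: add_mult_distrib sum_distrib_right del: distrib_left_numeral mult_Suc_right)
      (intro add_mono sum_mono; use * o r l in simp)
qed

section \<open>Programs with sparse rows\<close>

text \<open>Rows are association lists from variables to coefficients, so only the relevant blocks
  are listed; every absent variable gets the literal 0.\<close>

definition coef :: "(nat \<times> 'e expr) list \<Rightarrow> nat \<Rightarrow> 'e expr" where
  "coef es j = (case map_of es j of None \<Rightarrow> Numb 0 | Some e \<Rightarrow> e)"

text \<open>Distinct indices reconcile two readings of a row: \<open>coef\<close> takes the first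
  entry for an index, whereas \<open>row_val\<close> adds up all entries.\<close>

definition row_ok :: "nat \<Rightarrow> (nat \<times> 'e expr) list \<Rightarrow> bool" where
  "row_ok n es \<longleftrightarrow> distinct (map fst es) \<and> fst ` set es \<subseteq> {..<n}"

definition row_val :: "('e \<Rightarrow> real) \<Rightarrow> (nat \<times> 'e expr) list \<Rightarrow> (nat \<Rightarrow> real) \<Rightarrow> real" where
  "row_val f es z = (\<Sum>(j, e)\<leftarrow>es. expr_val f e * z j)"

definition sparse_program ::
    "nat \<Rightarrow> (nat \<times> 'e expr) list \<Rightarrow> ((nat \<times> 'e expr) list \<times> 'e expr) list \<Rightarrow> nat set \<Rightarrow> 'e expr program" where
  "sparse_program n c rs I = \<lparr>
     obj = vec n (coef c),
     lhs = mat (length rs) n (\<lambda>(i, j). coef (fst (rs ! i)) j),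
     rhs = vec (length rs) (\<lambda>i. snd (rs ! i)),
     int_vars = I\<rparr>"

lemma sum_coef:
  assumes "row_ok n es"
  shows "(\<Sum>j<n. expr_val f (coef es j) * z j) = row_val f es z"
  using assms
proof (induction es)
  case Nil
  then show ?case by (simp add: coef_def row_val_def)
next
  case (Cons x es)
  obtain i e where x: "x = (i, e)" by force
  have i: "i < n" and ni: "i \<notin> fst ` set es" and ok: "row_ok n es"
    using Cons.prems by (auto simp: row_ok_def x)
  have 0: "coef es i = Numb 0"
    using ni by (simp add: coef_def map_of_eq_None_iff[THEN iffD2])
  have "(\<Sum>j<n. expr_val f (coef (x # es) j) * z j) =
      (\<Sum>j<n. (if j = i then expr_val f e * z i else 0) + expr_val f (coef es j) * z j)"
    by (intro sum.cong) (use 0 in \<open>auto simp: coef_def x\<close>)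
  also have "\<dots> = expr_val f e * z i + row_val f es z"
    using i Cons.IH[OF ok] by (simp add: sum.distrib)
  finally show ?case by (simp add: row_val_def x)
qed

lemma row_val_append: "row_val f (r1 @ r2) z = row_val f r1 z + row_val f r2 z"
  by (simp add: row_val_def)

lemma row_val_Cons: "row_val f ((j, e) # r) z = expr_val f e * z j + row_val f r z"
  by (simp add: row_val_def)

lemma row_val_Nil: "row_val f [] z = 0"
  by (simp add: row_val_def)

lemma row_val_map_upt:
  "row_val f (map (\<lambda>j. (g j, h j)) [0..<n]) z = (\<Sum>j<n. expr_val f (h j) * z (g j))"
  by (simp add: row_val_def o_def interv_sum_list_conv_sum_set_nat atLeast0LessThan)

lemmas row_val_simps = row_val_append row_val_Cons row_val_Nil row_val_map_upt

lemma scalar_prod_obj_sparse: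
  assumes "row_ok n c" "z \<in> carrier_vec n"
  shows "obj (instantiate D (sparse_program n c rs I)) \<bullet> z = row_val (datum_val D) c (\<lambda>j. z $ j)"
  using assms(2) sum_coef[OF assms(1), of "datum_val D" "\<lambda>j. z $ j"]
  by (simp add: instantiate_def sparse_program_def scalar_prod_def atLeast0LessThan)

text \<open>Replaces the matrix inequality by one inequality per listed row, the form in which the
  constraints are analysed later.\<close>

lemma lp_feasible_sparse:
  assumes "\<forall>r\<in>set rs. row_ok n (fst r)"
  shows "lp_feasible (instantiate D (sparse_program n c rs I)) z \<longleftrightarrow>
    z \<in> carrier_vec n \<and>
    (\<forall>(r, b)\<in>set rs. row_val (datum_val D) r (\<lambda>j. z $ j) \<le> expr_val (datum_val D) b) \<and>
    (\<forall>j\<in>I. z $ j \<in> \<int>)"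
proof (cases "z \<in> carrier_vec n")
  case True
  let ?L = "instantiate D (sparse_program n c rs I)"
  have dims: "dim_row (lhs ?L) = length rs" "dim_vec (rhs ?L) = length rs"
    by (simp_all add: instantiate_def sparse_program_def)
  have "(lhs ?L *\<^sub>v z) $ i = row_val (datum_val D) (fst (rs ! i)) (\<lambda>j. z $ j)"
    if i: "i < length rs" for i
  proof -
    have "row_ok n (fst (rs ! i))" using assms i by simp
    from sum_coef[OF this, of "datum_val D" "\<lambda>j. z $ j"] show ?thesis
      using True i by (simp add: instantiate_def sparse_program_def scalar_prod_def atLeast0LessThan)
  qed
  moreover have "rhs ?L $ i = expr_val (datum_val D) (snd (rs ! i))" if "i < length rs" for i
    using that by (simp add: instantiate_def sparse_program_def)
  ultimately have "lhs ?L *\<^sub>v z \<le> rhs ?L \<longleftrightarrow>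
      (\<forall>i<length rs. row_val (datum_val D) (fst (rs ! i)) (\<lambda>j. z $ j)
         \<le> expr_val (datum_val D) (snd (rs ! i)))"
    using dims by (simp add: less_eq_vec_def)
  also have "\<dots> \<longleftrightarrow> (\<forall>(r, b)\<in>set rs. row_val (datum_val D) r (\<lambda>j. z $ j) \<le> expr_val (datum_val D) b)"
    by (auto simp: all_set_conv_all_nth case_prod_beta)
  finally show ?thesis
    using True by (simp add: lp_feasible_def instantiate_def sparse_program_def)
qed (simp add: lp_feasible_def instantiate_def sparse_program_def)

lemma coef_cases: "coef es j = Numb 0 \<or> coef es j \<in> snd ` set es"
  by (force simp: coef_def split: option.splits dest: map_of_SomeD)

lemma sparse_program_entries:
  assumes e: "e \<in> vec_set (obj T) \<union> elements_mat (lhs T) \<union> vec_set (rhs T)"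
    and T: "T = sparse_program n c rs I"
  shows "e = Numb 0 \<or> e \<in> snd ` set c \<or> (\<exists>(r, b)\<in>set rs. e \<in> snd ` set r \<or> e = b)"
proof -
  consider "e \<in> vec_set (obj T)" | "e \<in> elements_mat (lhs T)" | "e \<in> vec_set (rhs T)"
    using e by blast
  then show ?thesis
  proof cases
    case 1
    then show ?thesis using coef_cases[of c] by (auto simp: T sparse_program_def vec_set_def)
  next
    case 2
    then obtain i j where ij: "i < length rs" "e = coef (fst (rs ! i)) j"
      by (auto simp: T sparse_program_def dest!: elements_matD)
    then have "(fst (rs ! i), snd (rs ! i)) \<in> set rs" by simp
    then show ?thesis using coef_cases[of "fst (rs ! i)" j] ij(2) by blast
  next
    case 3
    then obtain i where ij: "i < length rs" "e = snd (rs ! i)"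
      by (auto simp: T sparse_program_def vec_set_def)
    then have "(fst (rs ! i), snd (rs ! i)) \<in> set rs" by simp
    then show ?thesis using ij(2) by blast
  qed
qed

lemma program_size_le:
  assumes "program_ok T"
    and "\<And>e. e \<in> vec_set (obj T) \<union> elements_mat (lhs T) \<union> vec_set (rhs T) \<Longrightarrow> f e \<le> E"
  shows "program_size f T \<le>
    (dim_vec (obj T) + dim_vec (rhs T) * dim_vec (obj T) + dim_vec (rhs T)) * E"
proof -
  have d: "dim_row (lhs T) = dim_vec (rhs T)" "dim_col (lhs T) = dim_vec (obj T)"
    using assms(1) by (auto simp: program_ok_def)
  have "(\<Sum>j<dim_vec (obj T). f (obj T $ j)) \<le> (\<Sum>j<dim_vec (obj T). E)"
    by (intro sum_mono assms(2)) (auto simp: vec_set_def)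
  moreover have "(\<Sum>i<dim_vec (rhs T). f (rhs T $ i)) \<le> (\<Sum>i<dim_vec (rhs T). E)"
    by (intro sum_mono assms(2)) (auto simp: vec_set_def)
  moreover have "(\<Sum>i<dim_row (lhs T). \<Sum>j<dim_col (lhs T). f (lhs T $$ (i, j)))
      \<le> (\<Sum>i<dim_row (lhs T). \<Sum>j<dim_col (lhs T). E)"
    by (intro sum_mono assms(2)) (auto intro!: elements_matI[OF carrier_matI])
  ultimately show ?thesis
    by (simp add: program_size_def d algebra_simps)
qed

section \<open>The program scheme\<close>

definition expr_sum :: "'e expr list \<Rightarrow> 'e expr" where
  "expr_sum es = foldr Plus es (Numb 0)"

lemma expr_val_sum: "expr_val f (expr_sum es) = (\<Sum>e\<leftarrow>es. expr_val f e)"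
  by (induction es) (auto simp: expr_sum_def)

lemma expr_size_sum: "expr_size (expr_sum es) = 1 + (\<Sum>e\<leftarrow>es. 1 + expr_size e)"
  by (induction es) (auto simp: expr_sum_def int_bits_def floorlog_def)

lemma set_expr_sum: "set_expr (expr_sum es) = (\<Union>e\<in>set es. set_expr e)"
  by (induction es) (auto simp: expr_sum_def)

text \<open>The same index as in \<open>y_part\<close>. After all policies come one epigraph
  variable and the breakpoints numbered 0 to \<open>n_pol F\<close>.\<close>

definition y_var :: "format \<Rightarrow> nat \<Rightarrow> nat \<Rightarrow> nat" where
  "y_var F i j = dim_x F + i * dim_y F + j"

definition max_var :: "format \<Rightarrow> nat" where
  "max_var F = dim_x F + n_pol F * dim_y F"

definition break_var :: "format \<Rightarrow> nat \<Rightarrow> nat" where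
  "break_var F i = max_var F + 1 + i"

definition num_vars :: "format \<Rightarrow> nat" where
  "num_vars F = max_var F + n_pol F + 2"

definition obj_row :: "format \<Rightarrow> (nat \<times> datum expr) list" where
  "obj_row F = map (\<lambda>j. (j, Entry (c_at j))) [0..<dim_x F] @ [(max_var F, Numb 1)]"

definition epi_row :: "format \<Rightarrow> nat \<Rightarrow> (nat \<times> datum expr) list" where
  "epi_row F i = map (\<lambda>j. (y_var F i j, Entry (d_at j))) [0..<dim_y F] @ [(max_var F, Numb (-1))]"

text \<open>
  On the segment from vertex 0 to vertex 1, parametrized by \<open>t\<close>, row \<open>r\<close> of the right-hand side
  is \<open>icpt F r - t * neg_slope F r\<close>.
\<close>

definition icpt :: "format \<Rightarrow> nat \<Rightarrow> datum expr" where
  "icpt F r = Plus (Entry (b_const_at r))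
     (expr_sum (map (\<lambda>l. Times (Entry (b_lin_at r l)) (Entry (vert_at 0 l))) [0..<dim_w F]))"

definition neg_slope :: "format \<Rightarrow> nat \<Rightarrow> datum expr" where
  "neg_slope F r = expr_sum (map (\<lambda>l. Times (Entry (b_lin_at r l))
     (Plus (Entry (vert_at 0 l)) (Times (Numb (-1)) (Entry (vert_at 1 l))))) [0..<dim_w F])"

text \<open>The breakpoint is a variable, so the term \<open>t * neg_slope F r\<close> of the
  right-hand side moves to the left, and \<open>icpt F r\<close> remains as the bound.\<close>

definition con_row :: "format \<Rightarrow> nat \<Rightarrow> nat \<Rightarrow> nat \<Rightarrow> (nat \<times> datum expr) list" where
  "con_row F i m r = map (\<lambda>j. (j, Entry (A_at r j))) [0..<dim_x F] @
     map (\<lambda>j. (y_var F i j, Entry (B_at r j))) [0..<dim_y F] @ [(break_var F m, neg_slope F r)]"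

text \<open>
  The auxiliary variables are the epigraph variable \<open>max_var\<close> and breakpoints
  \<open>t\<^sub>0 \<le> 0\<close>, \dots, \<open>t\<^sub>k \<ge> 1\<close>; policy \<open>i\<close> has to be feasible at \<open>t\<^sub>i\<close> and at \<open>t\<^sub>i\<^sub>+\<^sub>1\<close>. The breakpoints
  need not be ordered, since the path through them covers \<open>[0,1]\<close> in any case.
\<close>

definition con_rows :: "format \<Rightarrow> ((nat \<times> datum expr) list \<times> datum expr) list" where
  "con_rows F =
     map (\<lambda>i. (epi_row F i, Numb 0)) [0..<n_pol F] @
     [([(break_var F 0, Numb 1)], Numb 0), ([(break_var F (n_pol F), Numb (-1))], Numb (-1))] @
     concat (map (\<lambda>i. map (\<lambda>r. (con_row F i i r, icpt F r)) [0..<n_row F] @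
       map (\<lambda>r. (con_row F i (Suc i) r, icpt F r)) [0..<n_row F]) [0..<n_pol F])"

text \<open>
  A one-dimensional polytope has two vertices, and \<open>vert_at 0 l\<close>, \<open>vert_at 1 l\<close> are only
  meaningful in this case.
\<close>

definition adapt_scheme :: "format \<Rightarrow> datum expr program" where
  "adapt_scheme F = sparse_program (num_vars F) (obj_row F) (if n_vert F = 2 then con_rows F else [])
     (int_x F \<union> {y_var F i j | i j. i < n_pol F \<and> j \<in> int_y F})"

section \<open>Well-formedness and size of the scheme\<close>

lemma y_var_less: "i < n_pol F \<Longrightarrow> j < dim_y F \<Longrightarrow> y_var F i j < max_var F"
proof -
  assume "i < n_pol F" "j < dim_y F"
  then have "Suc i * dim_y F \<le> n_pol F * dim_y F" by (intro mult_le_mono) auto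
  then show ?thesis using \<open>j < dim_y F\<close> by (simp add: y_var_def max_var_def)
qed

lemma set_con_rows:
  "set (con_rows F) = (\<lambda>i. (epi_row F i, Numb 0)) ` {..<n_pol F} \<union>
     {([(break_var F 0, Numb 1)], Numb 0), ([(break_var F (n_pol F), Numb (-1))], Numb (-1))} \<union>
     (\<Union>i<n_pol F. \<Union>m\<in>{i, Suc i}. (\<lambda>r. (con_row F i m r, icpt F r)) ` {..<n_row F})"
  by (auto simp: con_rows_def atLeast0LessThan)

lemma row_ok_obj_row: "row_ok (num_vars F) (obj_row F)"
  by (auto simp: row_ok_def obj_row_def o_def max_var_def num_vars_def)

lemma row_ok_epi_row:
  assumes "i < n_pol F"
  shows "row_ok (num_vars F) (epi_row F i)"
proof -
  have "map fst (epi_row F i) = map (y_var F i) [0..<dim_y F] @ [max_var F]"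
    by (simp add: epi_row_def)
  moreover have "distinct (map (y_var F i) [0..<dim_y F])"
    by (auto simp: distinct_map inj_on_def y_var_def)
  moreover have "y_var F i j < max_var F" if "j \<in> set [0..<dim_y F]" for j
    using y_var_less[OF assms] that by simp
  ultimately show ?thesis
    unfolding row_ok_def set_map[symmetric] by (auto simp: num_vars_def) (force intro: less_trans)+
qed

text \<open>Indices of \<open>x\<close> lie below \<open>dim_x F\<close>, those of the policy from
  there up to \<open>max_var F\<close>, and the breakpoint beyond it, so none repeats.\<close>

lemma row_ok_con_row:
  assumes "i < n_pol F" "m \<le> n_pol F"
  shows "row_ok (num_vars F) (con_row F i m r)"
proof -
  have "map fst (con_row F i m r) = [0..<dim_x F] @ map (y_var F i) [0..<dim_y F] @ [break_var F m]"
    by (simp add: con_row_def o_def)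
  moreover have "distinct (map (y_var F i) [0..<dim_y F])"
    by (auto simp: distinct_map inj_on_def y_var_def)
  moreover have "dim_x F \<le> y_var F i j \<and> y_var F i j < max_var F" if "j \<in> set [0..<dim_y F]" for j
    using y_var_less[OF assms(1)] that by (simp add: y_var_def)
  moreover have "dim_x F \<le> max_var F" by (simp add: max_var_def)
  ultimately show ?thesis
    using assms(2) unfolding row_ok_def set_map[symmetric]
    by (auto simp: num_vars_def break_var_def not_less) (fastforce dest: leD)+
qed

lemma row_ok_con_rows: "\<forall>r\<in>set (con_rows F). row_ok (num_vars F) (fst r)"
  by (auto simp: set_con_rows row_ok_epi_row row_ok_con_row)
    (auto simp: row_ok_def break_var_def num_vars_def)

lemma all_con_rows:
  "(\<forall>(r, b)\<in>set (con_rows F). P r b) \<longleftrightarrow>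
     (\<forall>i<n_pol F. P (epi_row F i) (Numb 0)) \<and>
     P [(break_var F 0, Numb 1)] (Numb 0) \<and> P [(break_var F (n_pol F), Numb (-1))] (Numb (-1)) \<and>
     (\<forall>i<n_pol F. \<forall>m\<in>{i, Suc i}. \<forall>r<n_row F. P (con_row F i m r) (icpt F r))"
  by (simp add: set_con_rows ball_Un ball_conj_distrib) blast

text \<open>Serves both the size bound and the check that only available data occur. Vertices 0 and
  1 enter through \<open>icpt\<close> and \<open>neg_slope\<close> only, hence only if there are two
  vertices.\<close>

lemma adapt_scheme_entries:
  assumes e: "e \<in> vec_set (obj (adapt_scheme F)) \<union> elements_mat (lhs (adapt_scheme F)) \<union>
      vec_set (rhs (adapt_scheme F))"
  shows "e \<in> {Numb 0, Numb 1, Numb (-1)} \<or> (\<exists>x\<in>data_items F. e = Entry x) \<or>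
    n_vert F = 2 \<and> (\<exists>r<n_row F. e = icpt F r \<or> e = neg_slope F r)"
proof -
  consider "e = Numb 0" | "e \<in> snd ` set (obj_row F)"
    | c b where "n_vert F = 2" "(c, b) \<in> set (con_rows F)" "e \<in> snd ` set c \<or> e = b"
    using sparse_program_entries[OF e adapt_scheme_def] by (auto split: if_splits)
  then show ?thesis
    by cases (auto simp: set_con_rows obj_row_def epi_row_def con_row_def data_items_def)
qed

lemma expr_size_adapt_scheme_entry:
  assumes "1 \<le> n_pol F"
    and e: "e \<in> vec_set (obj (adapt_scheme F)) \<union> elements_mat (lhs (adapt_scheme F)) \<union>
      vec_set (rhs (adapt_scheme F))"
  shows "expr_size e \<le> 10 * format_size F"
proof -
  \<comment> \<open>The sizes are \<open>3 + 4 * dim_w F\<close> for \<open>icpt\<close> and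
    \<open>1 + 9 * dim_w F\<close> for \<open>neg_slope\<close>; the constant 10 is covered by
    \<open>n_pol F \<ge> 1\<close>.\<close>
  have s: "10 + 10 * dim_w F \<le> 10 * format_size F" using assms(1) by (simp add: format_size_def)
  have "expr_size (icpt F r) \<le> 10 * format_size F" for r
    using s by (simp add: icpt_def expr_size_sum o_def sum_list_triv)
  moreover have "expr_size (neg_slope F r) \<le> 10 * format_size F" for r
    using s by (simp add: neg_slope_def expr_size_sum o_def sum_list_triv int_bits_def floorlog_def)
  moreover have "expr_size x \<le> 10 * format_size F" if "x \<in> {Numb 0, Numb 1, Numb (-1)}" for x :: "datum expr"
    using s that by (auto simp: int_bits_def floorlog_def)
  moreover have "expr_size (Entry x) \<le> 10 * format_size F" for x :: datum
    using s by simp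
  ultimately show ?thesis using adapt_scheme_entries[OF e] by metis
qed

lemma set_expr_adapt_scheme_entry:
  assumes e: "e \<in> vec_set (obj (adapt_scheme F)) \<union> elements_mat (lhs (adapt_scheme F)) \<union>
      vec_set (rhs (adapt_scheme F))"
  shows "set_expr e \<subseteq> data_items F"
  using adapt_scheme_entries[OF e]
  by (auto simp: icpt_def neg_slope_def set_expr_sum data_items_def)

lemma program_ok_adapt_scheme:
  assumes "format_ok F"
  shows "program_ok (adapt_scheme F)"
proof -
  have "dim_x F \<le> max_var F" by (simp add: max_var_def)
  moreover have "j < dim_x F" if "j \<in> int_x F" for j
    using that assms by (auto simp: format_ok_def)
  moreover have "y_var F i j < max_var F" if "i < n_pol F" "j \<in> int_y F" for i j
    using y_var_less[OF that(1), of j] that(2) assms by (auto simp: format_ok_def)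
  ultimately have "int_x F \<union> {y_var F i j | i j. i < n_pol F \<and> j \<in> int_y F} \<subseteq> {..<num_vars F}"
    by (fastforce simp: num_vars_def)
  then show ?thesis
    by (simp add: program_ok_def adapt_scheme_def sparse_program_def)
qed

lemma scheme_ok_adapt_scheme:
  assumes "format_ok F"
  shows "scheme_ok F (adapt_scheme F)"
proof -
  have "dim_x F + n_pol F * dim_y F \<le> dim_vec (obj (adapt_scheme F))"
    by (simp add: adapt_scheme_def sparse_program_def num_vars_def max_var_def)
  then show ?thesis
    unfolding scheme_ok_def using program_ok_adapt_scheme[OF assms] set_expr_adapt_scheme_entry by blast
qed

text \<open>At most \<open>4 * s ^ 2\<close> variables and \<open>5 * s ^ 2\<close> rows make at
  most \<open>29 * s ^ 4\<close> entries, each of size at most \<open>10 * s\<close>.\<close>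

lemma program_size_adapt_scheme:
  assumes "format_ok F"
  shows "program_size expr_size (adapt_scheme F) \<le> 290 * format_size F ^ 5"
proof -
  define s where "s = format_size F"
  have k: "1 \<le> n_pol F" using assms by (simp add: format_ok_def)
  have s: "1 \<le> s" "dim_x F + n_pol F \<le> s" "n_pol F \<le> s" "dim_y F \<le> s" "n_row F \<le> s"
    using k by (auto simp: s_def format_size_def)
  have s2: "s \<le> s ^ 2" "s ^ 2 \<le> s ^ 4" "1 \<le> s ^ 2" using s(1) by (auto intro: power_increasing self_le_power)
  have V: "dim_vec (obj (adapt_scheme F)) \<le> 4 * s ^ 2"
  proof -
    have "n_pol F * dim_y F \<le> s ^ 2"
      unfolding power2_eq_square using s by (intro mult_le_mono)
    then show ?thesis using s s2
      by (simp add: adapt_scheme_def sparse_program_def num_vars_def max_var_def)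
  qed
  have R: "dim_vec (rhs (adapt_scheme F)) \<le> 5 * s ^ 2"
  proof -
    have "n_pol F * n_row F \<le> s ^ 2"
      unfolding power2_eq_square using s by (intro mult_le_mono)
    then have "length (con_rows F) \<le> 5 * s ^ 2" using s s2
      by (simp add: con_rows_def length_concat o_def sum_list_triv algebra_simps)
    then show ?thesis by (simp add: adapt_scheme_def sparse_program_def)
  qed
  have "program_size expr_size (adapt_scheme F) \<le>
    (dim_vec (obj (adapt_scheme F)) +
      dim_vec (rhs (adapt_scheme F)) * dim_vec (obj (adapt_scheme F)) +
      dim_vec (rhs (adapt_scheme F))) * (10 * s)"
    unfolding s_def
    by (intro program_size_le program_ok_adapt_scheme assms expr_size_adapt_scheme_entry k)
  also have "\<dots> \<le> (4 * s ^ 2 + (5 * s ^ 2) * (4 * s ^ 2) + 5 * s ^ 2) * (10 * s)"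
    by (intro mult_le_mono1 add_mono mult_le_mono V R)
  also have "\<dots> \<le> (29 * s ^ 4) * (10 * s)"
    using s2 by (intro mult_le_mono1) (simp add: power_add[symmetric])
  also have "\<dots> = 290 * s ^ 5" by (simp add: power_numeral_reduce)
  finally show ?thesis unfolding s_def .
qed

section \<open>Bounding the format by the encoding length of the data\<close>

lemma finite_data_items: "finite (data_items F)"
proof -
  have [simp]: "finite {f a b | a b. a < (m :: nat) \<and> b < (n :: nat)}" for f :: "nat \<Rightarrow> nat \<Rightarrow> datum" and m n
  proof -
    have "{f a b | a b. a < m \<and> b < n} = (\<lambda>(a, b). f a b) ` ({..<m} \<times> {..<n})" by auto
    then show ?thesis by simp
  qed
  show ?thesis by (simp add: data_items_def)
qed

lemma bits_pos: "1 \<le> bits r"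
  by (auto simp: bits_def int_bits_def split: prod.split)

lemma bits_le_data_size: "x \<in> data_items F \<Longrightarrow> bits (datum_val D x) \<le> data_size F D"
  unfolding data_size_def
  by (rule trans_le_add2, rule member_le_sum) (auto simp: finite_data_items)

text \<open>Each input number takes at least one bit, so \<open>n\<close> distinct ones contribute
  at least \<open>n\<close>.\<close>

lemma le_data_size:
  assumes "inj_on g {..<n}" "g ` {..<n} \<subseteq> data_items F"
  shows "n \<le> data_size F D"
proof -
  have "n = (\<Sum>x\<in>g ` {..<n}. 1)" using assms(1) by (simp add: card_image)
  also have "\<dots> \<le> (\<Sum>x\<in>g ` {..<n}. bits (datum_val D x))" by (intro sum_mono bits_pos)
  also have "\<dots> \<le> (\<Sum>x\<in>data_items F. bits (datum_val D x))"
    using assms(2) finite_data_items by (intro sum_mono2) auto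
  finally show ?thesis by (simp add: data_size_def)
qed

text \<open>Each of the four dimensions indexes a family of input numbers, \<open>dim_w F\<close>
  through the coordinates of vertex 0. With the policies this gives five terms; the two vertices
  account for the rest of the factor 7.\<close>

lemma format_size_le_data_size:
  assumes "format_ok F" "n_vert F = 2"
  shows "format_size F \<le> 7 * data_size F D"
proof -
  have "n_row F \<le> data_size F D" by (rule le_data_size[of b_const_at]) (auto simp: inj_on_def data_items_def)
  moreover have "dim_x F \<le> data_size F D" by (rule le_data_size[of c_at]) (auto simp: inj_on_def data_items_def)
  moreover have "dim_y F \<le> data_size F D" by (rule le_data_size[of d_at]) (auto simp: inj_on_def data_items_def)
  moreover have "dim_w F \<le> data_size F D"
    by (rule le_data_size[of "vert_at 0"]) (auto simp: inj_on_def data_items_def assms(2))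
  moreover have "1 \<le> n_pol F" "n_pol F \<le> data_size F D"
    using assms(1) by (auto simp: data_size_def format_ok_def)
  ultimately show ?thesis using assms(2) by (simp add: format_size_def)
qed

section \<open>Correctness\<close>

locale segment_instance =
  fixes F :: format and D :: data
  assumes F: "format_ok F" and D: "data_ok F D" and two: "n_vert F = 2"
begin

text \<open>The arguments are coordinate functions rather than vectors, so that a block of a program
  solution \<open>z\<close> can be inserted directly.\<close>

definition demand :: "(nat \<Rightarrow> real) \<Rightarrow> (nat \<Rightarrow> real) \<Rightarrow> nat \<Rightarrow> real" where
  "demand x y r = (\<Sum>j<dim_x F. A_mat D $$ (r, j) * x j) + (\<Sum>j<dim_y F. B_mat D $$ (r, j) * y j)"

text \<open>Written as intercept plus slope times \<open>t\<close>, to match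
  \<open>affine_ge_between\<close>.\<close>

definition capacity :: "nat \<Rightarrow> real \<Rightarrow> real" where
  "capacity r t = expr_val (datum_val D) (icpt F r) + (- expr_val (datum_val D) (neg_slope F r)) * t"

definition seg_pt :: "real \<Rightarrow> real vec" where
  "seg_pt t = vec (dim_w F) (\<lambda>l. (1 - t) * verts D ! 0 $ l + t * verts D ! 1 $ l)"

abbreviation "P \<equiv> problem F D"
abbreviation "L \<equiv> instantiate D (adapt_scheme F)"

lemma k_pos: "0 < n_pol F"
  using F by (simp add: format_ok_def)

lemma unc_problem: "unc P = seg_pt ` {0..1}"
proof -
  have l: "length (verts D) = 2" using D two by (simp add: data_ok_def)
  have "w \<in> conv_hull (dim_w F) (verts D) \<longleftrightarrow> w \<in> seg_pt ` {0..1}" for w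
  proof
    assume "w \<in> conv_hull (dim_w F) (verts D)"
    then obtain a where a: "w = vec (dim_w F) (\<lambda>l. a 0 * verts D ! 0 $ l + a 1 * verts D ! 1 $ l)"
      "0 \<le> a 0" "0 \<le> a 1" "a 0 + a (1 :: nat) = (1 :: real)"
      by (auto simp: conv_hull_def l numeral_2_eq_2 less_Suc_eq)
    then have "a 0 = 1 - a 1" by simp
    then have "w = seg_pt (a 1)" unfolding a(1) seg_pt_def by simp
    then show "w \<in> seg_pt ` {0..1}" using a by auto
  next
    assume "w \<in> seg_pt ` {0..1}"
    then obtain t where t: "w = seg_pt t" "0 \<le> t" "t \<le> 1" by auto
    then show "w \<in> conv_hull (dim_w F) (verts D)"
      unfolding conv_hull_def l
      by (intro CollectI exI[of _ "\<lambda>i. if i = 0 then 1 - t else t"])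
        (auto simp: seg_pt_def numeral_2_eq_2)
  qed
  then show ?thesis by (auto simp: problem_def)
qed

text \<open>As \<open>A\<close> and \<open>B\<close> are deterministic, \<open>w\<close> on the left
  is arbitrary; only the right-hand side depends on the point of the segment.\<close>

lemma satisfied_iff:
  assumes "x \<in> carrier_vec (dim_x F)" "y \<in> carrier_vec (dim_y F)"
  shows "Aof P w *\<^sub>v x + Bof P w *\<^sub>v y \<le> bof P (seg_pt t) \<longleftrightarrow>
    (\<forall>r<n_row F. demand (vec_index x) (vec_index y) r \<le> capacity r t)"
proof -
  have A: "A_mat D \<in> carrier_mat (n_row F) (dim_x F)" "B_mat D \<in> carrier_mat (n_row F) (dim_y F)"
    "b_const D \<in> carrier_vec (n_row F)" "b_lin D \<in> carrier_mat (n_row F) (dim_w F)"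
    using D by (auto simp: data_ok_def)
  have "(A_mat D *\<^sub>v x + B_mat D *\<^sub>v y) $ r = demand (vec_index x) (vec_index y) r"
    if "r < n_row F" for r
    using A assms that by (simp add: demand_def scalar_prod_def atLeast0LessThan)
  moreover have "(b_const D + b_lin D *\<^sub>v seg_pt t) $ r = capacity r t" if "r < n_row F" for r
    using A that
    by (simp add: capacity_def icpt_def neg_slope_def seg_pt_def scalar_prod_def expr_val_sum o_def
        interv_sum_list_conv_sum_set_nat atLeast0LessThan sum_distrib_left sum_distrib_right
        sum_negf[symmetric] sum.distrib[symmetric] algebra_simps)
  ultimately show ?thesis
    using A by (simp add: problem_def less_eq_vec_def)
qed

lemma lp_feasible_iff:
  "lp_feasible L z \<longleftrightarrow>
     z \<in> carrier_vec (num_vars F) \<and>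
     (\<forall>i<n_pol F. (\<Sum>j<dim_y F. d_vec D $ j * z $ y_var F i j) \<le> z $ max_var F) \<and>
     z $ break_var F 0 \<le> 0 \<and> 1 \<le> z $ break_var F (n_pol F) \<and>
     (\<forall>i<n_pol F. \<forall>m\<in>{i, Suc i}. \<forall>r<n_row F.
        demand (vec_index z) (\<lambda>j. z $ y_var F i j) r \<le> capacity r (z $ break_var F m)) \<and>
     (\<forall>j\<in>int_x F. z $ j \<in> \<int>) \<and> (\<forall>i<n_pol F. \<forall>j\<in>int_y F. z $ y_var F i j \<in> \<int>)"
proof -
  have 1: "row_val (datum_val D) (epi_row F i) (vec_index z) \<le> expr_val (datum_val D) (Numb 0)
      \<longleftrightarrow> (\<Sum>j<dim_y F. d_vec D $ j * z $ y_var F i j) \<le> z $ max_var F" for i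
    by (simp add: epi_row_def row_val_simps)
  have 2: "row_val (datum_val D) (con_row F i m r) (vec_index z) \<le> expr_val (datum_val D) (icpt F r)
      \<longleftrightarrow> demand (vec_index z) (\<lambda>j. z $ y_var F i j) r \<le> capacity r (z $ break_var F m)" for i m r
    by (simp add: con_row_def row_val_simps demand_def capacity_def algebra_simps)
  have 3: "row_val (datum_val D) [(v, Numb a)] (vec_index z) \<le> expr_val (datum_val D) (Numb b)
      \<longleftrightarrow> of_int a * z $ v \<le> of_int b" for v a b
    by (simp add: row_val_simps)
  have 4: "(\<forall>j\<in>int_x F \<union> {y_var F i j | i j. i < n_pol F \<and> j \<in> int_y F}. z $ j \<in> \<int>) \<longleftrightarrow>
      (\<forall>j\<in>int_x F. z $ j \<in> \<int>) \<and> (\<forall>i<n_pol F. \<forall>j\<in>int_y F. z $ y_var F i j \<in> \<int>)"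
    by blast
  show ?thesis
    unfolding adapt_scheme_def two lp_feasible_sparse[OF row_ok_con_rows] if_P[OF refl] all_con_rows 1 2 3 4
    by auto
qed

lemma obj_eq:
  assumes "z \<in> carrier_vec (num_vars F)"
  shows "obj L \<bullet> z = (\<Sum>j<dim_x F. c_vec D $ j * z $ j) + z $ max_var F"
  unfolding adapt_scheme_def scalar_prod_obj_sparse[OF row_ok_obj_row assms]
  by (simp add: obj_row_def row_val_simps)

text \<open>Every policy receives all scenarios at which it is feasible. Each \<open>s\<close> in
  \<open>{0..1}\<close> is crossed by a link of the breakpoint path, and the policy of that link is
  feasible at both its ends, hence at \<open>s\<close>. The epigraph variable dominates the true
  maximum.\<close>

lemma adapt_of_lp_feasible:
  assumes z: "lp_feasible L z"
  shows "\<exists>W. adapt_feasible P W (x_part F z) (y_part F z)"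
    and "adapt_obj P (x_part F z) (y_part F z) \<le> obj L \<bullet> z"
proof -
  note z = z[unfolded lp_feasible_iff]
  let ?x = "x_part F z" and ?y = "y_part F z"
  have c: "?x \<in> carrier_vec (dim_x F)" "?y i \<in> carrier_vec (dim_y F)" for i
    by (auto simp: x_part_def y_part_def)
  have dem: "demand (vec_index ?x) (vec_index (?y i)) r = demand (vec_index z) (\<lambda>j. z $ y_var F i j) r" for i r
    by (simp add: demand_def x_part_def y_part_def y_var_def)
  define W where "W i = {w \<in> unc P. Aof P w *\<^sub>v ?x + Bof P w *\<^sub>v ?y i \<le> bof P w}" for i
  have "seg_pt s \<in> (\<Union>i<n_pol F. W i)" if s: "s \<in> {0..1}" for s
  proof -
    have "z $ break_var F 0 \<le> s" "s \<le> z $ break_var F (n_pol F)"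
      using z s by auto
    from chain_crosses[of "\<lambda>i. z $ break_var F i", OF this k_pos]
    obtain i where i: "i < n_pol F" "z $ break_var F i \<le> s" "s \<le> z $ break_var F (Suc i)"
      by auto
    have "demand (vec_index ?x) (vec_index (?y i)) r \<le> capacity r s" if r: "r < n_row F" for r
    proof -
      have "demand (vec_index z) (\<lambda>j. z $ y_var F i j) r \<le> capacity r (z $ break_var F i)"
        "demand (vec_index z) (\<lambda>j. z $ y_var F i j) r \<le> capacity r (z $ break_var F (Suc i))"
        using z i(1) r by auto
      then show ?thesis
        unfolding dem capacity_def using i(2,3) by (rule affine_ge_between)
    qed
    then have "seg_pt s \<in> W i"
      unfolding W_def satisfied_iff[OF c] unc_problem using s
      by (simp add: satisfied_iff[OF c])
    then show ?thesis using i(1) by blast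
  qed
  then have "(\<Union>i<n_pol F. W i) = unc P"
    by (auto simp: W_def) (auto simp: unc_problem W_def)
  moreover have "?x \<in> xdom P" "?y i \<in> ydom P" if "i < n_pol F" for i
    using z that F c by (auto simp: problem_def x_part_def y_part_def y_var_def format_ok_def)
  ultimately have "adapt_feasible P W ?x ?y"
    using k_pos unfolding adapt_feasible_def by (auto simp: W_def problem_def)
  then show "\<exists>W. adapt_feasible P W ?x ?y" by blast
  have "d_vec D \<bullet> ?y i \<le> z $ max_var F" if "i < n_pol F" for i
    using z that by (simp add: scalar_prod_def y_part_def y_var_def atLeast0LessThan)
  then have "Max ((\<lambda>i. d_vec D \<bullet> ?y i) ` {..<n_pol F}) \<le> z $ max_var F"
    using k_pos by (intro Max.boundedI) auto
  moreover have "c_vec D \<bullet> ?x = (\<Sum>j<dim_x F. c_vec D $ j * z $ j)"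
    by (simp add: scalar_prod_def x_part_def atLeast0LessThan)
  ultimately show "adapt_obj P ?x ?y \<le> obj L \<bullet> z"
    using z by (simp add: obj_eq adapt_obj_def problem_def)
qed

text \<open>The regions \<open>W i\<close> are arbitrary sets, so they are replaced by the closed
  sets \<open>J i\<close> of all parameters at which policy \<open>i\<close> is feasible. The chain
  through this cover supplies the breakpoints and the selection \<open>\<sigma>\<close> of
  policies.\<close>

lemma lp_of_adapt_feasible:
  assumes W: "adapt_feasible P W x y"
  shows "\<exists>z. lp_feasible L z \<and> obj L \<bullet> z \<le> adapt_obj P x y"
proof -
  have cover: "(\<Union>i<n_pol F. W i) = unc P"
    and x: "x \<in> carrier_vec (dim_x F)" "\<forall>j\<in>int_x F. x $ j \<in> \<int>"
    and y: "\<And>i. i < n_pol F \<Longrightarrow> y i \<in> carrier_vec (dim_y F)"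
      "\<And>i j. i < n_pol F \<Longrightarrow> j \<in> int_y F \<Longrightarrow> y i $ j \<in> \<int>"
    and sat: "\<And>i w. i < n_pol F \<Longrightarrow> w \<in> W i \<Longrightarrow> Aof P w *\<^sub>v x + Bof P w *\<^sub>v y i \<le> bof P w"
    using W by (auto simp: adapt_feasible_def problem_def)
  define J where "J i = {t. \<forall>r<n_row F. demand (vec_index x) (vec_index (y i)) r \<le> capacity r t}" for i
  have "closed (J i)" for i
    unfolding J_def capacity_def
    by (intro closed_Collect_all closed_Collect_imp closed_Collect_le continuous_intros) auto
  moreover have "{0..1} \<subseteq> (\<Union>i\<in>{..<n_pol F}. J i)"
  proof
    fix t :: real assume "t \<in> {0..1}"
    then have "seg_pt t \<in> (\<Union>i<n_pol F. W i)" unfolding cover unc_problem by blast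
    then obtain i where i: "i < n_pol F" "seg_pt t \<in> W i" by blast
    then have "t \<in> J i" using sat[OF i] satisfied_iff[OF x(1) y(1)[OF i(1)]] by (simp add: J_def)
    then show "t \<in> (\<Union>i\<in>{..<n_pol F}. J i)" using i(1) by blast
  qed
  ultimately obtain \<sigma> t where \<sigma>t: "t 0 = 0" "t (n_pol F) = 1"
    "\<And>i. i < n_pol F \<Longrightarrow> \<sigma> i < n_pol F \<and> t i \<in> J (\<sigma> i) \<and> t (Suc i) \<in> J (\<sigma> i)"
    using closed_cover_chain[of "{..<n_pol F}" J 0 1] by auto
  \<comment> \<open>The maximum runs over all original policies, including any that
    \<open>\<sigma>\<close> skips: the epigraph rows hold and the two objective values are
    equal.\<close>
  define M where "M = Max ((\<lambda>i. d_vec D \<bullet> y i) ` {..<n_pol F})"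
  \<comment> \<open>Quotient and remainder by \<open>dim_y F\<close> decode \<open>y_var\<close>;
    slot \<open>i\<close> holds policy \<open>\<sigma> i\<close>. The final \<open>- 1\<close> steps
    over the epigraph variable.\<close>
  define z where "z = vec (num_vars F) (\<lambda>v.
    if v < dim_x F then x $ v
    else if v < max_var F then y (\<sigma> ((v - dim_x F) div dim_y F)) $ ((v - dim_x F) mod dim_y F)
    else if v = max_var F then M else t (v - max_var F - 1))"
  have zx: "z $ j = x $ j" if "j < dim_x F" for j
    using that by (simp add: z_def num_vars_def max_var_def)
  have zy: "z $ y_var F i j = y (\<sigma> i) $ j" if "i < n_pol F" "j < dim_y F" for i j
  proof -
    have "y_var F i j < num_vars F" "y_var F i j < max_var F" "dim_x F \<le> y_var F i j"
      using y_var_less[OF that] by (auto simp: num_vars_def y_var_def)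
    then show ?thesis using that(2) by (simp add: z_def) (simp add: y_var_def add.assoc)
  qed
  have zm: "z $ max_var F = M"
    by (simp add: z_def num_vars_def) (simp add: max_var_def)
  have zt: "z $ break_var F m = t m" if "m \<le> n_pol F" for m
    using that by (simp add: z_def num_vars_def break_var_def) (simp add: max_var_def)
  have dem: "demand (vec_index z) (\<lambda>j. z $ y_var F i j) r = demand (vec_index x) (vec_index (y (\<sigma> i))) r"
    if "i < n_pol F" for i r
    using that by (simp add: demand_def zx zy)
  have zc: "z \<in> carrier_vec (num_vars F)" by (simp add: z_def)
  have "lp_feasible L z"
    unfolding lp_feasible_iff
  proof (intro conjI allI impI ballI)
    fix i assume i: "i < n_pol F"
    have "(\<Sum>j<dim_y F. d_vec D $ j * z $ y_var F i j) = d_vec D \<bullet> y (\<sigma> i)"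
      using i y(1)[of "\<sigma> i"] \<sigma>t(3)[OF i] by (simp add: zy scalar_prod_def atLeast0LessThan)
    also have "\<dots> \<le> M" unfolding M_def using \<sigma>t(3)[OF i] by (intro Max_ge) auto
    finally show "(\<Sum>j<dim_y F. d_vec D $ j * z $ y_var F i j) \<le> z $ max_var F" by (simp add: zm)
    show "demand (vec_index z) (\<lambda>j. z $ y_var F i j) r \<le> capacity r (z $ break_var F m)"
      if "m \<in> {i, Suc i}" "r < n_row F" for m r
      using that \<sigma>t(3)[OF i] i by (auto simp: dem zt J_def)
    show "z $ y_var F i j \<in> \<int>" if "j \<in> int_y F" for j
      using that i F y(2)[of "\<sigma> i" j] \<sigma>t(3)[OF i] by (subst zy) (auto simp: format_ok_def)
  next
    show "z $ j \<in> \<int>" if "j \<in> int_x F" for j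
      using that F x(2) by (subst zx) (auto simp: format_ok_def)
  qed (use zc \<sigma>t zt in auto)
  moreover have "c_vec D \<bullet> x = (\<Sum>j<dim_x F. c_vec D $ j * z $ j)"
    using x(1) by (simp add: zx scalar_prod_def atLeast0LessThan)
  then have "obj L \<bullet> z = adapt_obj P x y"
    by (simp add: obj_eq[OF zc] zm M_def adapt_obj_def problem_def)
  ultimately show ?thesis by auto
qed

text \<open>Each translation yields a feasible point that is no worse, so the infima agree, infinite
  values included, and optimality transfers both ways.\<close>

lemma solves_adapt_scheme: "solves L F D"
  unfolding solves_def
proof (intro conjI allI impI)
  show "lp_value L = adapt_value P"
    unfolding lp_value_def adapt_value_def
  proof (rule antisym)
    show "Inf {ereal (obj L \<bullet> z) | z. lp_feasible L z} \<le>
        Inf {ereal (adapt_obj P x y) | x y. \<exists>W. adapt_feasible P W x y}"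
      by (rule Inf_mono) (use lp_of_adapt_feasible in fastforce)
    show "Inf {ereal (adapt_obj P x y) | x y. \<exists>W. adapt_feasible P W x y} \<le>
        Inf {ereal (obj L \<bullet> z) | z. lp_feasible L z}"
      by (rule Inf_mono) (use adapt_of_lp_feasible in fastforce)
  qed
next
  fix z assume z: "lp_optimal L z"
  have "adapt_obj P (x_part F z) (y_part F z) \<le> adapt_obj P x' y'" if f: "adapt_feasible P W' x' y'" for W' x' y'
  proof -
    obtain z' where "lp_feasible L z'" "obj L \<bullet> z' \<le> adapt_obj P x' y'"
      using lp_of_adapt_feasible[OF f] by blast
    then show ?thesis using z adapt_of_lp_feasible(2)[of z] unfolding lp_optimal_def by fastforce
  qed
  then show "adapt_optimal P (x_part F z) (y_part F z)"
    using z adapt_of_lp_feasible(1) unfolding adapt_optimal_def lp_optimal_def by blast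
next
  assume "\<exists>x y. adapt_optimal P x y"
  then obtain x y W where opt: "adapt_optimal P x y" and W: "adapt_feasible P W x y"
    unfolding adapt_optimal_def by blast
  obtain z where z: "lp_feasible L z" "obj L \<bullet> z \<le> adapt_obj P x y"
    using lp_of_adapt_feasible[OF W] by blast
  have "obj L \<bullet> z \<le> obj L \<bullet> z'" if "lp_feasible L z'" for z'
    using adapt_of_lp_feasible[OF that] opt z(2) unfolding adapt_optimal_def by fastforce
  then show "\<exists>z. lp_optimal L z" using z(1) unfolding lp_optimal_def by blast
qed

end

section \<open>Uniform polynomial bounds for the scheme and its instances\<close>

theorem proposition1p3:
  shows "\<exists>p :: nat poly. \<forall>F. format_ok F \<longrightarrow>
    (\<exists>T. scheme_ok F T \<and>
         (int_x F = {} \<and> int_y F = {} \<longrightarrow> int_vars T = {}) \<and>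
         program_size expr_size T \<le> poly p (format_size F) \<and>
         (\<forall>D. data_ok F D \<and> affine_dim (dim_w F) (unc (problem F D)) = 1 \<longrightarrow>
              solves (instantiate D T) F D \<and>
              (rational_data F D \<longrightarrow>
                 program_size bits (instantiate D T) \<le> poly p (data_size F D))))"
proof (intro exI allI impI)
  \<comment> \<open>With format size \<open>s\<close> and data size \<open>d\<close>, the factors
    come from \<open>290 * s ^ 5\<close>, \<open>s \<le> 7 * d\<close> and
    \<open>2 * d + 4 \<le> 6 * d\<close>. The result also dominates the degree 5 bound in the format
    size.\<close>
  let ?p = "monom (290 * 7 ^ 5 * 6) 6 :: nat poly"
  fix F assume F: "format_ok F"
  show "scheme_ok F (adapt_scheme F) \<and>
         (int_x F = {} \<and> int_y F = {} \<longrightarrow> int_vars (adapt_scheme F) = {}) \<and>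
         program_size expr_size (adapt_scheme F) \<le> poly ?p (format_size F) \<and>
         (\<forall>D. data_ok F D \<and> affine_dim (dim_w F) (unc (problem F D)) = 1 \<longrightarrow>
              solves (instantiate D (adapt_scheme F)) F D \<and>
              (rational_data F D \<longrightarrow>
                 program_size bits (instantiate D (adapt_scheme F)) \<le> poly ?p (data_size F D)))"
  proof (intro conjI allI impI)
    show "scheme_ok F (adapt_scheme F)" by (rule scheme_ok_adapt_scheme[OF F])
    show "int_vars (adapt_scheme F) = {}" if "int_x F = {} \<and> int_y F = {}"
      using that by (simp add: adapt_scheme_def sparse_program_def)
    have "1 \<le> format_size F" using F by (simp add: format_ok_def format_size_def)
    then have "format_size F ^ 5 \<le> format_size F ^ 6" by (intro power_increasing) auto
    then show "program_size expr_size (adapt_scheme F) \<le> poly ?p (format_size F)"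
      using program_size_adapt_scheme[OF F] by (simp add: poly_monom)
  next
    fix D assume D: "data_ok F D \<and> affine_dim (dim_w F) (unc (problem F D)) = 1"
    \<comment> \<open>Dimension one fixes the number of vertices, so the constraints of
      \<open>adapt_scheme\<close> are present; formats with another number of vertices admit no such
      \<open>D\<close>.\<close>
    then have two: "n_vert F = 2"
      using length_eq_2_of_affine_dim_1[of "verts D" "dim_w F"]
      by (auto simp: data_ok_def problem_def)
    interpret segment_instance F D using F D two by unfold_locales auto
    show "solves L F D" by (rule solves_adapt_scheme)
    assume rat: "rational_data F D"
    define d where "d = data_size F D"
    have d: "1 \<le> d" using k_pos by (simp add: d_def data_size_def)
    have "program_size bits L \<le> program_size expr_size (adapt_scheme F) * (2 * d + 4)"
      using rat bits_le_data_size unfolding d_def rational_data_def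
      by (intro program_size_instantiate_le[OF scheme_ok_adapt_scheme[OF F]]) auto
    also have "\<dots> \<le> (290 * format_size F ^ 5) * (2 * d + 4)"
      by (intro mult_le_mono1 program_size_adapt_scheme F)
    also have "\<dots> \<le> (290 * (7 * d) ^ 5) * (6 * d)"
      unfolding d_def using format_size_le_data_size[OF F two, of D] d
      by (intro mult_le_mono power_mono) (auto simp: d_def)
    also have "\<dots> = poly ?p d"
      by (simp add: poly_monom power_mult_distrib power_numeral_reduce)
    finally show "program_size bits L \<le> poly ?p (data_size F D)" unfolding d_def .
  qed
qed

end
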